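(* Let $G$ be an isostatic point-hyperplane graph in $\mathbb{R}^d$ and let $(G,p,\ell)$ be a minimally pinned framework on $G$ whose (pinned) rigidity matrix has a kernel of dimension one. The extension of the infinitesimal flex of $(G,p,\ell)$ to a finite flex is linearly detectable (with respect to the given pinning) if and only if the linear push algorithm, applied to $(G,p,\ell)$, terminates with this determination (i.e. with the output "extends to a linearly detectable finite flex").
   Context: **Frameworks.** A $\mathcal{PH}$-graph (point-hyperplane graph) is a finite simple graph $G=(V_{\mathcal P}\cup V_{\mathcal H},E)$ with vertex set partitioned into $V_{\mathcal P}$ (size $n$) and $V_{\mathcal H}$ (size $k$); $E$ is partitioned into $E_{\mathcal{PP}},E_{\mathcal{PH}},E_{\mathcal{HH}}$. A point-hyperplane framework $(G,p,\ell)$ in $\mathbb{R}^d$ has $p:V_{\mathcal P}\to\mathbb{R}^d$, $\ell=(a,r):V_{\mathcal H}\to(\mathbb{R}^d\setminus\{0\})\times\mathbb{R}$; $j\in V_{\mathcal H}$ represents the hyperplane $\{x:\langle a_j,x\rangle=r_j\}$. The edges of $E_{\mathcal{HH}}$ whose hyperplanes are parallel at $(p,\ell)$ form $E_{\mathcal{HH}\parallel}$, the others $E_{\mathcal{HH}\not\parallel}$. The constraint functions are $\|p_i-p_j\|^2$ ($\{i,j\}\in E_{\mathcal{PP}}$), $\langle p_i,a_j\rangle-r_j$ ($\{i,j\}\in E_{\mathcal{PH}}$), $\langle a_i,a_j\rangle$ ($\{i,j\}\in E_{\mathcal{HH}\not\parallel}$), $\langle a_j,a_j\rangle$ ($j\in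 V_{\mathcal H}$), and for $\{i,j\}\in E_{\mathcal{HH}\parallel}$ the $d-1$ functions $\det(D_s)$, $s=1,\ldots,d-1$, where $D_s$ has rows $a_i,a_j,u_1,\ldots,u_{s-1},u_{s+1},\ldots,u_{d-1}$ and $u_1,\ldots,u_{d-1}$ are fixed vectors forming with the value of $a_i$ at $(p,\ell)$ an orthogonal basis of $\mathbb{R}^d$. The rigidity matrix $R(G,q,m)$ at $(q,m)\in\mathbb{R}^{dn+(d+1)k}$ is the Jacobian of these functions (up to scaling of rows); infinitesimal motions of $(G,q,m)$ are elements of its kernel. A trivial infinitesimal motion of $(G,p,\ell)$ has $\dot p_i=Sp_i+b$, $(\dot a_j,\dot r_j)=(Sa_j,\langle b,a_j\rangle)$ for some skew-symmetric $S$ and $b\in\mathbb{R}^d$; a non-trivial infinitesimal motion is an infinitesimal flex. A framework is isostatic if all its infinitesimal motions are trivial and the rows of its rigidity matrix are linearly independent; the graph $G$ is isostatic if its generic realisations are isostatic. **Minimal pinning.** Let $P=(c_1,\ldots,c_{d(d+1)/2})$ be a set of coordinates of the configuration, minimal with respect to containment, such that (i) it includes all the coordinates of at least one point vertex and (ii) restricting the measurement map to constant values of the coordinates in $P$ gives a rigidity matrix with no (non-zero) trivial motions. Frameworks with these coordinates fixed are called minimally pinned with respect to $P$. For minimally pinned frameworks, $f$ denotes the measurement map with this restriction incorporated: $df(q,m)$ is $R(G,q,m)$ with the columns of $P$ deleted, and vectors in its kernel are regarded as vectors of $\mathbb{R}^{dn+(d+1)k}$ with zero entries at the coordinates in $P$.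 All affine subspaces $\mathscr A$ below contain $(p,\ell)$ and have the coordinates in $P$ constant. For an affine subspace $\mathscr A=(p,\ell)+\mathscr B$, $\tilde f$ is the restriction of $f$ to $\mathscr A$, so $d\tilde f(q,m)$ is the restriction of $df(q,m)$ to $\mathscr B$; a point $(q,m)\in\mathscr A$ is $\mathscr A$-regular if $\mathrm{rank}\,d\tilde f$ at $(q,m)$ is the maximum over some neighborhood of $(q,m)$ in $\mathscr A$. **Linear detectability.** The infinitesimal flex $(\dot p,\dot\ell)$ (the generator of the kernel of $df(p,\ell)$) of the minimally pinned framework extends to a finite flex which is linearly detectable if (1) the space of infinitesimal motions of the unpinned framework has dimension $d(d+1)/2+1$, and (2) there is an affine subspace $\mathscr A\subseteq\mathbb{R}^{dn+(d+1)k}$ such that $(p,\ell)$ is an $\mathscr A$-regular point and the infinitesimal flex generates the kernel of $d\tilde f(p,\ell)$. **Linear push algorithm.** Let $X(q,m)$ be the null space of $df(q,m)$. Start with $\mathscr B=\langle(\dot p,\dot\ell)\rangle$, $\mathscr A=(p,\ell)+\mathscr B$. Repeat: choose $(q,m)$ to be a random point of $\mathscr A$ (i.e. a generic point: $\mathscr A$-regular and with $\mathrm{rank}\,df(q,m)$ maximal over $\mathscr A$). If $\mathrm{rank}(df(q,m))>\mathrm{rank}(df(p,\ell))$, stop with output "does not extend to a linearly detectable finite flex". Otherwise, if $X(q,m)\subseteq\mathscr B$, stop with output "extends to a linearly detectable finite flex (in the affine space $\mathscr A$)". Otherwise let $v$ be a unit vector generating $X(q,m)$, replace $\mathscr B$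 by $\mathscr B+\langle v\rangle$ and $\mathscr A$ by $(p,\ell)+\mathscr B$, and repeat. *)

theory Defs
  imports "HOL-Analysis.Analysis"
begin

text \<open>
  The vertex set is the finite type \<^typ>\<open>'v\<close>, the disjoint union of the point vertices and the
  hyperplane vertices. The latter may be absent, which is why a single vertex type is split by a
  set instead of using one (nonempty) type for each kind. The space is \<^typ>\<open>real^'d\<close>, with
  \<open>d = CARD('d)\<close>.
\<close>

record 'v ph_graph =
  pt_verts :: "'v set"
  edges :: "'v set set"

definition hyp_verts :: "'v ph_graph \<Rightarrow> 'v set" where
  "hyp_verts G = - pt_verts G"

definition simple_ph_graph :: "'v::finite ph_graph \<Rightarrow> bool" where
  "simple_ph_graph G \<longleftrightarrow> (\<forall>e\<in>edges G. card e = 2)"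

text \<open>
  A configuration has the coordinates \<open>(i, Some s)\<close>, the \<open>s\<close>-th coordinate of the point \<open>p\<^sub>i\<close> or of the
  normal \<open>a\<^sub>i\<close>, and \<open>(j, None)\<close>, the number \<open>r\<^sub>j\<close> of a hyperplane vertex \<open>j\<close>. The entries
  \<open>(i, None)\<close> at point vertices carry no information and are set to zero, so that \<open>conf_space G\<close>
  below is the space of dimension \<open>dn + (d+1)k\<close> of the pairs \<open>(p, \<ell>)\<close>.
\<close>

type_synonym ('v, 'd) coord = "'v \<times> 'd option"

type_synonym ('v, 'd) config = "real ^ ('v, 'd) coord"

definition vecpart :: "('v::finite, 'd::finite) config \<Rightarrow> 'v \<Rightarrow> real^'d" where
  "vecpart x i = (\<chi> s. x $ (i, Some s))"

definition scalpart :: "('v::finite, 'd::finite) config \<Rightarrow> 'v \<Rightarrow> real" where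
  "scalpart x j = x $ (j, None)"

definition coords :: "'v ph_graph \<Rightarrow> ('v, 'd) coord set" where
  "coords G = {(i, c). c = None \<longrightarrow> i \<in> hyp_verts G}"

definition conf_space :: "'v ph_graph \<Rightarrow> ('v::finite, 'd::finite) config set" where
  "conf_space G = {x. \<forall>k. k \<notin> coords G \<longrightarrow> x $ k = 0}"

definition ph_framework :: "'v ph_graph \<Rightarrow> ('v::finite, 'd::finite) config \<Rightarrow> bool" where
  "ph_framework G x \<longleftrightarrow> simple_ph_graph G \<and> x \<in> conf_space G \<and>
     (\<forall>j\<in>hyp_verts G. vecpart x j \<noteq> 0)"

definition parallel_edges ::
    "'v ph_graph \<Rightarrow> ('v::finite, 'd::finite) config \<Rightarrow> 'v set set" where
  "parallel_edges G x0 =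
     {e \<in> edges G. e \<subseteq> hyp_verts G \<and> collinear (insert 0 (vecpart x0 ` e))}"

text \<open>
  The arbitrary choices made in writing down the constraints: a naming \<open>(i, j)\<close> of the ends of each
  edge, and for every parallel edge an orthogonal basis of \<^typ>\<open>real^'d\<close> completing \<open>a\<^sub>i\<close>. The basis
  is indexed by \<^typ>\<open>'d\<close> with \<open>a\<^sub>i\<close> at the index \<open>normal_ix\<close>, so \<open>u\<^sub>1, \<dots>, u\<^bsub>d-1\<^esub>\<close> are the vectors
  at the remaining \<open>d - 1\<close> indices.
\<close>

record ('v, 'd) labelling =
  ends :: "'v set \<Rightarrow> 'v \<times> 'v"
  normal_ix :: 'd
  frame :: "'v set \<Rightarrow> 'd \<Rightarrow> real^'d"

definition orthogonal_basis :: "('d \<Rightarrow> real^'d::finite) \<Rightarrow> bool" where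
  "orthogonal_basis u \<longleftrightarrow> inj u \<and> pairwise orthogonal (range u) \<and>
     independent (range u) \<and> span (range u) = UNIV"

definition is_labelling ::
    "'v ph_graph \<Rightarrow> ('v::finite, 'd::finite) config \<Rightarrow> ('v, 'd) labelling \<Rightarrow> bool" where
  "is_labelling G x0 L \<longleftrightarrow>
     (\<forall>e\<in>edges G. e = {fst (ends L e), snd (ends L e)} \<and>
        (e \<inter> pt_verts G \<noteq> {} \<longrightarrow> fst (ends L e) \<in> pt_verts G)) \<and>
     (\<forall>e\<in>parallel_edges G x0. orthogonal_basis (frame L e) \<and>
        frame L e (normal_ix L) = vecpart x0 (fst (ends L e)))"

text \<open>
  Constraints: \<open>Inl j\<close> for \<open>\<langle>a\<^sub>j, a\<^sub>j\<rangle>\<close>, \<open>Inr (Inl e)\<close> for the single constraint of an edge \<open>e\<close> which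
  is not a parallel edge, and \<open>Inr (Inr (e, s))\<close> for \<open>det D\<^sub>s\<close> at a parallel edge \<open>e\<close>.
\<close>

type_synonym ('v, 'd) constr = "'v + 'v set + 'v set \<times> 'd"

definition constraints ::
    "'v ph_graph \<Rightarrow> ('v, 'd) labelling \<Rightarrow> ('v::finite, 'd::finite) config \<Rightarrow> ('v, 'd) constr set" where
  "constraints G L x0 =
     {Inl j | j. j \<in> hyp_verts G} \<union>
     {Inr (Inl e) | e. e \<in> edges G - parallel_edges G x0} \<union>
     {Inr (Inr (e, s)) | e s. e \<in> parallel_edges G x0 \<and> s \<noteq> normal_ix L}"

definition edge_fun ::
    "'v ph_graph \<Rightarrow> ('v, 'd) labelling \<Rightarrow> 'v set \<Rightarrow> ('v::finite, 'd::finite) config \<Rightarrow> real" where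
  "edge_fun G L e x = (let i = fst (ends L e); j = snd (ends L e) in
     if e \<subseteq> pt_verts G then (norm (vecpart x i - vecpart x j))\<^sup>2
     else if e \<subseteq> hyp_verts G then vecpart x i \<bullet> vecpart x j
     else vecpart x i \<bullet> vecpart x j - scalpart x j)"

text \<open>
  The rows of \<open>D\<^sub>s\<close> are placed with \<open>a\<^sub>i\<close> at \<open>normal_ix\<close>, \<open>a\<^sub>j\<close> at \<open>s\<close> and every other \<open>u\<^sub>t\<close> at \<open>t\<close>;
  any other order of the rows changes the determinant only by a sign.
\<close>

definition parallel_fun ::
    "('v, 'd) labelling \<Rightarrow> 'v set \<Rightarrow> 'd \<Rightarrow> ('v::finite, 'd::finite) config \<Rightarrow> real" where
  "parallel_fun L e s x = det (\<chi> t.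
     if t = normal_ix L then vecpart x (fst (ends L e))
     else if t = s then vecpart x (snd (ends L e))
     else frame L e t)"

text \<open>
  The set of constraints is determined at the framework \<open>x0\<close> and does not vary with \<open>x\<close>. Indices
  which are not constraints give zero components, hence zero rows of the rigidity matrix.
\<close>

definition measurement ::
    "'v ph_graph \<Rightarrow> ('v, 'd) labelling \<Rightarrow> ('v, 'd) config \<Rightarrow> ('v::finite, 'd::finite) config \<Rightarrow>
     real ^ ('v, 'd) constr" where
  "measurement G L x0 x = (\<chi> c. if c \<in> constraints G L x0 then
     (case c of
        Inl j \<Rightarrow> vecpart x j \<bullet> vecpart x j
      | Inr (Inl e) \<Rightarrow> edge_fun G L e x
      | Inr (Inr (e, s)) \<Rightarrow> parallel_fun L e s x)
     else 0)"

definition rigidity_matrix ::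
    "'v ph_graph \<Rightarrow> ('v, 'd) labelling \<Rightarrow> ('v, 'd) config \<Rightarrow> ('v::finite, 'd::finite) config \<Rightarrow>
     real ^ ('v, 'd) coord ^ ('v, 'd) constr" where
  "rigidity_matrix G L x0 x = jacobian (measurement G L x0) (at x)"

definition inf_motions ::
    "'v ph_graph \<Rightarrow> ('v, 'd) labelling \<Rightarrow> ('v, 'd) config \<Rightarrow> ('v::finite, 'd::finite) config \<Rightarrow>
     ('v, 'd) config set" where
  "inf_motions G L x0 x = {v \<in> conf_space G. rigidity_matrix G L x0 x *v v = 0}"

definition trivial_motions ::
    "'v ph_graph \<Rightarrow> ('v::finite, 'd::finite) config \<Rightarrow> ('v, 'd) config set" where
  "trivial_motions G x = {v \<in> conf_space G. \<exists>(S :: real^'d^'d) b. transpose S = - S \<and>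
     (\<forall>i\<in>pt_verts G. vecpart v i = S *v vecpart x i + b) \<and>
     (\<forall>j\<in>hyp_verts G. vecpart v j = S *v vecpart x j \<and> scalpart v j = b \<bullet> vecpart x j)}"

definition isostatic_framework ::
    "'v ph_graph \<Rightarrow> ('v, 'd) labelling \<Rightarrow> ('v::finite, 'd::finite) config \<Rightarrow> bool" where
  "isostatic_framework G L x \<longleftrightarrow>
     inf_motions G L x x \<subseteq> trivial_motions G x \<and>
     inj_on (\<lambda>c. rigidity_matrix G L x x $ c) (constraints G L x) \<and>
     independent ((\<lambda>c. rigidity_matrix G L x x $ c) ` constraints G L x)"

text \<open>
  Algebraic independence over the rationals of the family \<open>x k\<close>, \<open>k \<in> K\<close>: the function \<open>m\<close> is the
  vector of exponents of a monomial, and \<open>c m\<close> is its coefficient.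
\<close>

definition alg_independent :: "('k::finite \<Rightarrow> real) \<Rightarrow> 'k set \<Rightarrow> bool" where
  "alg_independent x K \<longleftrightarrow>
     (\<forall>M (c :: ('k \<Rightarrow> nat) \<Rightarrow> rat). finite M \<and> (\<forall>m\<in>M. \<forall>k. k \<notin> K \<longrightarrow> m k = 0) \<and>
        (\<Sum>m\<in>M. of_rat (c m) * (\<Prod>k\<in>K. x k ^ m k)) = 0 \<longrightarrow> (\<forall>m\<in>M. c m = 0))"

definition generic_framework :: "'v ph_graph \<Rightarrow> ('v::finite, 'd::finite) config \<Rightarrow> bool" where
  "generic_framework G x \<longleftrightarrow> ph_framework G x \<and> alg_independent (\<lambda>k. x $ k) (coords G)"

definition isostatic_graph :: "'d::finite itself \<Rightarrow> 'v::finite ph_graph \<Rightarrow> bool" where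
  "isostatic_graph (T :: 'd itself) G \<longleftrightarrow> simple_ph_graph G \<and>
     (\<forall>(x :: ('v, 'd) config) L. generic_framework G x \<and> is_labelling G x L \<longrightarrow>
        isostatic_framework G L x)"

text \<open>
  Deleting the columns in \<open>P\<close> is rendered by setting them to zero; a vector in the kernel has zero
  entries in \<open>P\<close>.
\<close>

definition pinned_matrix ::
    "'v ph_graph \<Rightarrow> ('v, 'd) labelling \<Rightarrow> ('v, 'd) coord set \<Rightarrow> ('v, 'd) config \<Rightarrow>
     ('v::finite, 'd::finite) config \<Rightarrow> real ^ ('v, 'd) coord ^ ('v, 'd) constr" where
  "pinned_matrix G L P x0 q = (\<chi> c k. if k \<in> P then 0 else rigidity_matrix G L x0 q $ c $ k)"

definition pinned_kernel ::
    "'v ph_graph \<Rightarrow> ('v, 'd) labelling \<Rightarrow> ('v, 'd) coord set \<Rightarrow> ('v, 'd) config \<Rightarrow>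
     ('v::finite, 'd::finite) config \<Rightarrow> ('v, 'd) config set" where
  "pinned_kernel G L P x0 q =
     {v \<in> conf_space G. (\<forall>k\<in>P. v $ k = 0) \<and> pinned_matrix G L P x0 q *v v = 0}"

definition pins ::
    "'v ph_graph \<Rightarrow> ('v, 'd) labelling \<Rightarrow> ('v::finite, 'd::finite) config \<Rightarrow>
     ('v, 'd) coord set \<Rightarrow> bool" where
  "pins G L x0 P \<longleftrightarrow> P \<subseteq> coords G \<and>
     (\<exists>i\<in>pt_verts G. \<forall>s. (i, Some s) \<in> P) \<and>
     pinned_kernel G L P x0 x0 \<inter> trivial_motions G x0 \<subseteq> {0}"

definition minimal_pinning ::
    "'v ph_graph \<Rightarrow> ('v, 'd) labelling \<Rightarrow> ('v::finite, 'd::finite) config \<Rightarrow>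
     ('v, 'd) coord set \<Rightarrow> bool" where
  "minimal_pinning G L x0 P \<longleftrightarrow> card P = CARD('d) * (CARD('d) + 1) div 2 \<and>
     pins G L x0 P \<and> (\<forall>P'. P' \<subset> P \<longrightarrow> \<not> pins G L x0 P')"

definition pinned_affine ::
    "'v ph_graph \<Rightarrow> ('v, 'd) coord set \<Rightarrow> ('v::finite, 'd::finite) config \<Rightarrow>
     ('v, 'd) config set \<Rightarrow> bool" where
  "pinned_affine G P x0 A \<longleftrightarrow> affine A \<and> x0 \<in> A \<and> A \<subseteq> conf_space G \<and>
     (\<forall>x\<in>A. \<forall>k\<in>P. x $ k = x0 $ k)"

definition direction :: "'a::ab_group_add set \<Rightarrow> 'a set" where
  "direction A = {x - y | x y. x \<in> A \<and> y \<in> A}"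

definition rank_along ::
    "'v ph_graph \<Rightarrow> ('v, 'd) labelling \<Rightarrow> ('v, 'd) coord set \<Rightarrow> ('v, 'd) config \<Rightarrow>
     ('v, 'd) config set \<Rightarrow> ('v::finite, 'd::finite) config \<Rightarrow> nat" where
  "rank_along G L P x0 A q = dim ((*v) (pinned_matrix G L P x0 q) ` direction A)"

definition regular_point ::
    "'v ph_graph \<Rightarrow> ('v, 'd) labelling \<Rightarrow> ('v, 'd) coord set \<Rightarrow> ('v, 'd) config \<Rightarrow>
     ('v, 'd) config set \<Rightarrow> ('v::finite, 'd::finite) config \<Rightarrow> bool" where
  "regular_point G L P x0 A q \<longleftrightarrow> q \<in> A \<and>
     (\<exists>U. open U \<and> q \<in> U \<and>
        (\<forall>q'\<in>U \<inter> A. rank_along G L P x0 A q' \<le> rank_along G L P x0 A q))"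

definition linearly_detectable ::
    "'v ph_graph \<Rightarrow> ('v, 'd) labelling \<Rightarrow> ('v, 'd) coord set \<Rightarrow> ('v::finite, 'd::finite) config \<Rightarrow>
     ('v, 'd) config \<Rightarrow> bool" where
  "linearly_detectable G L P x0 w \<longleftrightarrow>
     dim (inf_motions G L x0 x0) = CARD('d) * (CARD('d) + 1) div 2 + 1 \<and>
     (\<exists>A. pinned_affine G P x0 A \<and> regular_point G L P x0 A x0 \<and>
        {v \<in> direction A. pinned_matrix G L P x0 x0 *v v = 0} = span {w})"

text \<open>
  A state is the current direction space \<open>B\<close>, or one of the two outputs. The random choices make the
  algorithm nondeterministic.
\<close>

datatype 'a push_state = Running "'a set" | Extends "'a set" | Does_Not_Extend

definition random_point ::
    "'v ph_graph \<Rightarrow> ('v, 'd) labelling \<Rightarrow> ('v, 'd) coord set \<Rightarrow> ('v, 'd) config \<Rightarrow>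
     ('v, 'd) config set \<Rightarrow> ('v::finite, 'd::finite) config \<Rightarrow> bool" where
  "random_point G L P x0 A q \<longleftrightarrow> regular_point G L P x0 A q \<and>
     (\<forall>q'\<in>A. rank (pinned_matrix G L P x0 q') \<le> rank (pinned_matrix G L P x0 q))"

inductive push_step ::
    "'v ph_graph \<Rightarrow> ('v, 'd) labelling \<Rightarrow> ('v, 'd) coord set \<Rightarrow> ('v::finite, 'd::finite) config \<Rightarrow>
     ('v, 'd) config push_state \<Rightarrow> ('v, 'd) config push_state \<Rightarrow> bool"
  for G L P x0 where
  "push_step G L P x0 (Running B) Does_Not_Extend"
    if "random_point G L P x0 ((+) x0 ` B) q"
      "rank (pinned_matrix G L P x0 q) > rank (pinned_matrix G L P x0 x0)"
| "push_step G L P x0 (Running B) (Extends ((+) x0 ` B))"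
    if "random_point G L P x0 ((+) x0 ` B) q"
      "\<not> rank (pinned_matrix G L P x0 q) > rank (pinned_matrix G L P x0 x0)"
      "pinned_kernel G L P x0 q \<subseteq> B"
| "push_step G L P x0 (Running B) (Running (span (insert v B)))"
    if "random_point G L P x0 ((+) x0 ` B) q"
      "\<not> rank (pinned_matrix G L P x0 q) > rank (pinned_matrix G L P x0 x0)"
      "\<not> pinned_kernel G L P x0 q \<subseteq> B"
      "norm v = 1" "pinned_kernel G L P x0 q = span {v}"

text \<open>
  One execution of the algorithm, for some sequence of random choices. It repeats its last state once
  no further step is possible, so the output, if there is one, is the final value of the sequence.
\<close>

definition push_execution ::
    "'v ph_graph \<Rightarrow> ('v, 'd) labelling \<Rightarrow> ('v, 'd) coord set \<Rightarrow> ('v::finite, 'd::finite) config \<Rightarrow>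
     ('v, 'd) config \<Rightarrow> (nat \<Rightarrow> ('v, 'd) config push_state) \<Rightarrow> bool" where
  "push_execution G L P x0 w \<sigma> \<longleftrightarrow> \<sigma> 0 = Running (span {w}) \<and>
     (\<forall>t. if \<exists>s. push_step G L P x0 (\<sigma> t) s
          then push_step G L P x0 (\<sigma> t) (\<sigma> (Suc t))
          else \<sigma> (Suc t) = \<sigma> t)"

end

theory Submission
  imports Defs
begin

text \<open>
  The rigidity matrix depends polynomially on the configuration, so on an affine space its rank and
  its rank along any direction space are maximal on dense sets; in particular every local maximum
  of the rank is global.

  If detectability is witnessed by \<open>x\<^sub>0 + B'\<close>, then at every point \<open>q\<close> of this space the pinned
  kernel \<open>X q\<close> meets \<open>B'\<close> nontrivially. Hence the rank never exceeds its value at \<open>x\<^sub>0\<close>, and at the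
  random points chosen by the algorithm \<open>X q\<close> is a line inside \<open>B'\<close>: the growing space \<open>B\<close> stays in
  \<open>B'\<close>, and the algorithm must stop with a positive answer. Conversely, when it stops with
  \<open>X q \<subseteq> B\<close>, the ranks along \<open>B\<close> at \<open>q\<close> and at \<open>x\<^sub>0\<close> are both \<open>dim B - 1\<close>, so \<open>x\<^sub>0\<close> is regular.
\<close>

section \<open>Ranks of polynomial matrices\<close>

text \<open>Rank-nullity on a subspace: a linear right inverse \<open>g\<close> of \<open>f\<close>
  with values in \<open>S\<close> carries the image injectively onto a complement of the kernel in
  \<open>S\<close>.\<close>

lemma dim_image_add_dim_kernel:
  fixes f :: "'a::euclidean_space \<Rightarrow> 'b::euclidean_space"
  assumes f: "linear f" and S: "subspace S"
  shows "dim (f ` S) + dim {x \<in> S. f x = 0} = dim S"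
proof -
  obtain g where g: "range g \<subseteq> S" "linear g" "\<forall>v\<in>f ` S. f (g v) = v"
    using linear_exists_right_inverse_on[OF f S] by auto
  let ?C = "g ` f ` S" and ?K = "{x \<in> S. f x = 0}"
  have fS: "subspace (f ` S)"
    using f S by (rule linear_subspace_image)
  have C: "subspace ?C"
    using g(2) fS by (rule linear_subspace_image)
  have K: "subspace ?K"
    using S f by (auto simp: subspace_def linear_0 linear_add linear_scale)
  have "{x + y |x y. x \<in> ?C \<and> y \<in> ?K} = S"
  proof (intro equalityI subsetI)
    fix z assume "z \<in> {x + y |x y. x \<in> ?C \<and> y \<in> ?K}"
    then show "z \<in> S"
      using g(1) S by (auto intro!: subspace_add)
  next
    fix z assume z: "z \<in> S"
    then have "g (f z) \<in> ?C" "z - g (f z) \<in> ?K"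
      using g S by (auto intro: subspace_diff simp: linear_diff[OF f])
    moreover have "z = g (f z) + (z - g (f z))"
      by simp
    ultimately show "z \<in> {x + y |x y. x \<in> ?C \<and> y \<in> ?K}"
      by blast
  qed
  moreover have "?C \<inter> ?K = {0}"
  proof (intro equalityI subsetI)
    fix z assume "z \<in> ?C \<inter> ?K"
    then show "z \<in> {0}"
      using g(3) linear_0[OF g(2)] by auto
  next
    fix z :: 'a assume "z \<in> {0}"
    then show "z \<in> ?C \<inter> ?K"
      using subspace_0[OF C] subspace_0[OF K] by simp
  qed
  moreover have "dim ?C = dim (f ` S)"
  proof (rule dim_image_eq[OF g(2)])
    have "inj_on g (f ` S)"
      using g(3) by (intro inj_on_inverseI[of _ f]) blast
    then show "inj_on g (span (f ` S))"
      using fS by (simp add: span_eq_iff[THEN iffD2])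
  qed
  ultimately show ?thesis
    using dim_sums_Int[OF C K] by simp
qed

section \<open>Polynomial functions: derivatives, zeros on lines, determinants\<close>

lemma real_polynomial_function_has_derivative:
  assumes "real_polynomial_function p"
  obtains p' where "\<And>x. (p has_derivative p' x) (at x)"
    and "\<And>h. real_polynomial_function (\<lambda>x. p' x h)"
proof -
  have "\<exists>p'. (\<forall>x. (p has_derivative p' x) (at x)) \<and> (\<forall>h. real_polynomial_function (\<lambda>x. p' x h))"
    using assms
  proof induction
    case (linear f)
    then show ?case
      by (intro exI[of _ "\<lambda>x. f"] conjI allI bounded_linear_imp_has_derivative
          real_polynomial_function.intros(2))
  next
    case (const c)
    show ?case
      by (intro exI[of _ "\<lambda>x h. 0"] conjI allI has_derivative_const real_polynomial_function.intros(2))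
  next
    case (add f g)
    then obtain f' g' where "\<forall>x. (f has_derivative f' x) (at x)" "\<forall>x. (g has_derivative g' x) (at x)"
      "\<forall>h. real_polynomial_function (\<lambda>x. f' x h)" "\<forall>h. real_polynomial_function (\<lambda>x. g' x h)"
      by blast
    then show ?case
      by (intro exI[of _ "\<lambda>x h. f' x h + g' x h"] conjI allI has_derivative_add
          real_polynomial_function.intros(3)) simp_all
  next
    case (mult f g)
    then obtain f' g' where "\<forall>x. (f has_derivative f' x) (at x)" "\<forall>x. (g has_derivative g' x) (at x)"
      "\<forall>h. real_polynomial_function (\<lambda>x. f' x h)" "\<forall>h. real_polynomial_function (\<lambda>x. g' x h)"
      by blast
    then show ?case using mult.hyps
      by (intro exI[of _ "\<lambda>x h. f x * g' x h + f' x h * g x"] conjI allI has_derivative_mult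
          real_polynomial_function.intros(3) real_polynomial_function.intros(4)) simp_all
  qed
  then show ?thesis using that by blast
qed

text \<open>Along the line \<open>p\<close> is a univariate polynomial, and its value at
  \<open>t0\<close> shows that some coefficient is nonzero.\<close>

lemma finite_zeros_real_polynomial_function_line:
  fixes a b :: "'a::euclidean_space"
  assumes p: "real_polynomial_function p" and nz: "p (a + t0 *\<^sub>R b) \<noteq> 0"
  shows "finite {t. p (a + t *\<^sub>R b) = 0}"
proof -
  have "polynomial_function (\<lambda>t::real. a + t *\<^sub>R b)"
    by (intro polynomial_function_add polynomial_function_const
        polynomial_function_bounded_linear[OF bounded_linear_scaleR_left])
  then have "real_polynomial_function (p \<circ> (\<lambda>t::real. a + t *\<^sub>R b))"
    using p by (rule real_polynomial_function_compose)
  then obtain c n where c: "p \<circ> (\<lambda>t. a + t *\<^sub>R b) = (\<lambda>t. \<Sum>i\<le>n. c i * t ^ i)"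
    using real_polynomial_function_imp_sum by blast
  then have eq: "p (a + t *\<^sub>R b) = (\<Sum>i\<le>n. c i * t ^ i)" for t
    by (metis comp_apply)
  then have "\<exists>i\<le>n. c i \<noteq> 0"
    using nz by (metis (no_types, lifting) atMost_iff mult_zero_left sum.neutral)
  then show ?thesis
    unfolding eq using polyfun_finite_roots by blast
qed

lemma real_polynomial_function_det:
  fixes F :: "'a::real_normed_vector \<Rightarrow> real^'n^'n"
  assumes "\<And>i j. real_polynomial_function (\<lambda>x. F x $ i $ j)"
  shows "real_polynomial_function (\<lambda>x. det (F x))"
  unfolding det_def
  by (intro real_polynomial_function_sum real_polynomial_function.intros(4)
      real_polynomial_function.intros(2) real_polynomial_function_prod assms) simp_all

text \<open>
  With \<open>g\<close> a right inverse of \<open>F q\<^sub>1\<close> on \<open>F q\<^sub>1 ` B\<close> and \<open>\<pi>\<close> a projection onto that image, the square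
  matrix \<open>F q g \<pi> + 1 - \<pi>\<close> is the identity at \<open>q\<^sub>1\<close>, and wherever it is invertible \<open>F q\<close> is injective
  on the range of \<open>g \<pi>\<close>.
\<close>
lemma polynomial_witness_of_rank:
  fixes F :: "'a::euclidean_space \<Rightarrow> real^'n^'m"
  assumes F: "\<And>i j. real_polynomial_function (\<lambda>x. F x $ i $ j)" and B: "subspace B"
  obtains p where "real_polynomial_function p" "p q1 \<noteq> 0"
    and "\<And>q. p q \<noteq> 0 \<Longrightarrow> dim ((*v) (F q1) ` B) \<le> dim ((*v) (F q) ` B)"
proof -
  let ?D = "(*v) (F q1) ` B"
  have D: "subspace ?D"
    by (rule linear_subspace_image[OF _ B]) simp
  obtain g where g: "range g \<subseteq> B" "linear g" "\<forall>v\<in>?D. F q1 *v g v = v"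
    using linear_exists_right_inverse_on[OF _ B, of "(*v) (F q1)"] by auto
  \<comment> \<open>A right inverse of the identity on \<open>?D\<close> with values in
    \<open>?D\<close> is a projection onto \<open>?D\<close>.\<close>
  obtain \<pi> where \<pi>: "range \<pi> \<subseteq> ?D" "linear \<pi>" "\<forall>v\<in>?D. \<pi> v = v"
    using linear_exists_right_inverse_on[OF linear_id D] by auto
  define H where "H q = F q ** matrix (g \<circ> \<pi>) + (mat 1 - matrix \<pi>)" for q
  have H: "H q *v y = F q *v g (\<pi> y) + (y - \<pi> y)" for q y
    unfolding H_def using g(2) \<pi>(2)
    by (simp add: matrix_vector_mult_add_rdistrib matrix_vector_mult_diff_rdistrib
        matrix_vector_mul_assoc[symmetric] matrix_works linear_compose)
  have "H q1 = mat 1"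
  proof -
    have "F q1 *v g (\<pi> y) = \<pi> y" for y
      using bspec[OF g(3), of "\<pi> y"] \<pi>(1) by blast
    then show ?thesis
      unfolding matrix_eq H by simp
  qed
  moreover have "real_polynomial_function (\<lambda>q. det (H q))"
  proof (rule real_polynomial_function_det)
    fix i j
    have "H q $ i $ j = (\<Sum>k\<in>UNIV. F q $ i $ k * matrix (g \<circ> \<pi>) $ k $ j) + (mat 1 - matrix \<pi>) $ i $ j" for q
      by (simp add: H_def matrix_matrix_mult_def)
    then show "real_polynomial_function (\<lambda>q. H q $ i $ j)"
      by (simp only:) (intro real_polynomial_function.intros(3) real_polynomial_function_sum
        real_polynomial_function.intros(4) real_polynomial_function.intros(2) F finite)
  qed
  moreover have "dim ?D \<le> dim ((*v) (F q) ` B)" if "det (H q) \<noteq> 0" for q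
  proof -
    have inj: "inj ((*v) (H q))"
      using that by (simp add: invertible_det_nz[symmetric] inj_matrix_vector_mult)
    have eq: "H q *v y = F q *v g y" if "y \<in> ?D" for y
      unfolding H using bspec[OF \<pi>(3) that] by simp
    \<comment> \<open>On \<open>?D\<close> the injective map \<open>H q\<close> agrees with
      \<open>F q\<close> after \<open>g\<close>, so it embeds \<open>?D\<close> into the image of
      \<open>B\<close> under \<open>F q\<close>.\<close>
    have "dim ?D = dim ((*v) (H q) ` ?D)"
      using inj by (intro dim_image_eq[symmetric]) (auto intro: inj_on_subset)
    also have "(*v) (H q) ` ?D \<subseteq> (*v) (F q) ` B"
    proof (rule image_subsetI)
      fix y assume "y \<in> ?D"
      then have "H q *v y = F q *v g y"
        by (rule eq)
      moreover have "g y \<in> B"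
        using g(1) by blast
      ultimately show "H q *v y \<in> (*v) (F q) ` B"
        by blast
    qed
    then have "dim ((*v) (H q) ` ?D) \<le> dim ((*v) (F q) ` B)"
      by (rule dim_subset)
    finally show ?thesis .
  qed
  ultimately show ?thesis
    using that[of "\<lambda>q. det (H q)"] by simp
qed

lemma jacobian_real_polynomial_function:
  fixes f :: "real^'n \<Rightarrow> real^'m"
  assumes "\<And>c. real_polynomial_function (\<lambda>x. f x $ c)"
  shows "f differentiable (at x)"
    and "real_polynomial_function (\<lambda>x. jacobian f (at x) $ c $ k)"
proof -
  have "\<forall>c. \<exists>p'. (\<forall>x. ((\<lambda>x. f x $ c) has_derivative p' x) (at x)) \<and>
      (\<forall>h. real_polynomial_function (\<lambda>x. p' x h))"
    using real_polynomial_function_has_derivative[OF assms] by metis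
  then obtain p' where p': "\<And>c x. ((\<lambda>x. f x $ c) has_derivative p' c x) (at x)"
    "\<And>c h. real_polynomial_function (\<lambda>x. p' c x h)"
    by metis
  have D: "(f has_derivative (\<lambda>h. \<chi> c. p' c x h)) (at x)" for x
    unfolding has_derivative_componentwise_within[of f]
    using p'(1) by (auto simp: Basis_vec_def inner_axis)
  show "f differentiable (at x)"
    using D differentiable_def by blast
  show "real_polynomial_function (\<lambda>x. jacobian f (at x) $ c $ k)"
    using p'(2) by (simp add: jacobian_def matrix_def frechet_derivative_at[OF D, symmetric])
qed

text \<open>By the chain rule, the Jacobian applied to \<open>v\<close> is the derivative at 0 of a
  constant function of \<open>t\<close>.\<close>

lemma jacobian_eq_0_if_constant_on_line:
  fixes f :: "real^'n \<Rightarrow> real^'m"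
  assumes f: "f differentiable (at x)" and const: "\<And>t. f (x + t *\<^sub>R v) = f x"
  shows "jacobian f (at x) *v v = 0"
proof -
  \<comment> \<open>\<open>0 *\<^sub>R v\<close> presents the base point as the value of the line at
    parameter 0, the form required for the composition.\<close>
  have "(f has_derivative (\<lambda>h. jacobian f (at x) *v h)) (at (x + 0 *\<^sub>R v))"
    using f by (simp add: jacobian_works)
  moreover have "((\<lambda>t. x + t *\<^sub>R v) has_derivative (\<lambda>t. t *\<^sub>R v)) (at 0)"
    by (auto intro!: derivative_eq_intros)
  ultimately have "((\<lambda>t. f (x + t *\<^sub>R v)) has_derivative (\<lambda>t. jacobian f (at x) *v (t *\<^sub>R v))) (at 0)"
    by (rule has_derivative_compose[rotated])
  then have "((\<lambda>t. f x) has_derivative (\<lambda>t::real. jacobian f (at x) *v (t *\<^sub>R v))) (at 0)"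
    by (simp add: const)
  then have "(\<lambda>t::real. jacobian f (at x) *v (t *\<^sub>R v)) = (\<lambda>t. 0)"
    using has_derivative_unique has_derivative_const by blast
  then show ?thesis
    by (metis scaleR_one)
qed

section \<open>The rigidity matrix\<close>

lemma real_polynomial_function_vec_nth:
  fixes i :: "'n::finite"
  shows "real_polynomial_function (\<lambda>x::real^'n. x $ i)"
  by (rule real_polynomial_function.intros(1)) (rule bounded_linear_vec_nth)

lemma real_polynomial_function_vecpart:
  "real_polynomial_function (\<lambda>x. vecpart x i $ s)"
  by (simp add: vecpart_def real_polynomial_function_vec_nth)

lemma real_polynomial_function_inner:
  fixes f g :: "'a::real_normed_vector \<Rightarrow> real^'n"
  assumes "\<And>s. real_polynomial_function (\<lambda>x. f x $ s)"
    and "\<And>s. real_polynomial_function (\<lambda>x. g x $ s)"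
  shows "real_polynomial_function (\<lambda>x. f x \<bullet> g x)"
  unfolding inner_vec_def inner_real_def
  by (intro real_polynomial_function_sum real_polynomial_function.intros(4) assms finite)

lemma real_polynomial_function_edge_fun:
  "real_polynomial_function (edge_fun G L e)"
proof -
  let ?i = "fst (ends L e)" and ?j = "snd (ends L e)"
  have "real_polynomial_function (\<lambda>x. (vecpart x ?i - vecpart x ?j) \<bullet> (vecpart x ?i - vecpart x ?j))"
    by (rule real_polynomial_function_inner; unfold vector_minus_component)
      (rule real_polynomial_function_diff real_polynomial_function_vecpart)+
  moreover have inner: "real_polynomial_function (\<lambda>x. vecpart x ?i \<bullet> vecpart x ?j)"
    by (rule real_polynomial_function_inner) (rule real_polynomial_function_vecpart)+
  moreover have "real_polynomial_function (\<lambda>x. vecpart x ?i \<bullet> vecpart x ?j - scalpart x ?j)"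
    unfolding scalpart_def
    by (rule real_polynomial_function_diff[OF inner real_polynomial_function_vec_nth])
  ultimately show ?thesis
    unfolding edge_fun_def Let_def power2_norm_eq_inner
    by (cases "e \<subseteq> pt_verts G"; cases "e \<subseteq> hyp_verts G") simp_all
qed

lemma real_polynomial_function_parallel_fun:
  "real_polynomial_function (parallel_fun L e s)"
  unfolding parallel_fun_def
proof (rule real_polynomial_function_det)
  fix t k
  show "real_polynomial_function (\<lambda>x. (\<chi> t. if t = normal_ix L then vecpart x (fst (ends L e))
      else if t = s then vecpart x (snd (ends L e)) else frame L e t) $ t $ k)"
    by (cases "t = normal_ix L"; cases "t = s")
      (simp_all add: real_polynomial_function_vecpart real_polynomial_function.intros(2))
qed

lemma real_polynomial_function_measurement:
  "real_polynomial_function (\<lambda>x. measurement G L x0 x $ c)"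
proof (cases "c \<in> constraints G L x0")
  case True
  have norm: "real_polynomial_function (\<lambda>x. vecpart x j \<bullet> vecpart x j)" for j
    by (rule real_polynomial_function_inner) (rule real_polynomial_function_vecpart)+
  consider j where "c = Inl j" | e where "c = Inr (Inl e)" | e s where "c = Inr (Inr (e, s))"
    by (cases c rule: sum.exhaust) (metis sum.exhaust surj_pair)+
  then show ?thesis
    using True by cases (simp_all add: measurement_def norm real_polynomial_function_edge_fun
        real_polynomial_function_parallel_fun)
next
  case False
  then show ?thesis
    by (simp add: measurement_def real_polynomial_function.intros(2))
qed

lemma real_polynomial_function_pinned_matrix:
  "real_polynomial_function (\<lambda>q. pinned_matrix G L P x0 q $ c $ k)"
  by (cases "k \<in> P") (simp_all add: pinned_matrix_def rigidity_matrix_def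
      real_polynomial_function.intros(2)
      jacobian_real_polynomial_function(2)[OF real_polynomial_function_measurement])

text \<open>Translation by \<open>b\<close> keeps differences of points and all normals. In a
  point-hyperplane constraint both the inner product and the offset grow by the inner product of
  \<open>b\<close> with the normal, and these changes cancel.\<close>

lemma measurement_translate:
  assumes L: "is_labelling G x0 L"
    and pt: "\<And>i. i \<in> pt_verts G \<Longrightarrow> vecpart y i = vecpart x i + b"
    and hyp: "\<And>j. j \<in> hyp_verts G \<Longrightarrow> vecpart y j = vecpart x j"
      "\<And>j. j \<in> hyp_verts G \<Longrightarrow> scalpart y j = scalpart x j + b \<bullet> vecpart x j"
  shows "measurement G L x0 y = measurement G L x0 x"
proof -
  have edge: "edge_fun G L e y = edge_fun G L e x" if "e \<in> edges G" for e
  proof -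
    obtain i j where ij: "ends L e = (i, j)"
      by fastforce
    have e: "e = {i, j}" "e \<inter> pt_verts G \<noteq> {} \<Longrightarrow> i \<in> pt_verts G"
      using L that ij by (auto simp: is_labelling_def)
    \<comment> \<open>The labelling names the point end first, so a mixed edge gives a single
      case.\<close>
    then consider "e \<subseteq> pt_verts G" "i \<in> pt_verts G" "j \<in> pt_verts G"
      | "\<not> e \<subseteq> pt_verts G" "e \<subseteq> hyp_verts G" "i \<in> hyp_verts G" "j \<in> hyp_verts G"
      | "\<not> e \<subseteq> pt_verts G" "\<not> e \<subseteq> hyp_verts G" "i \<in> pt_verts G" "j \<in> hyp_verts G"
      unfolding hyp_verts_def by blast
    then show ?thesis
      by cases (simp_all add: edge_fun_def Let_def ij pt hyp inner_add_left)
  qed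
  have "vecpart y i = vecpart x i" if "e \<in> parallel_edges G x0" "i \<in> {fst (ends L e), snd (ends L e)}" for e i
  proof -
    have "e = {fst (ends L e), snd (ends L e)}" "e \<subseteq> hyp_verts G"
      using that(1) L by (auto simp: is_labelling_def parallel_edges_def)
    then show ?thesis
      using that(2) hyp(1) by blast
  qed
  then have "parallel_fun L e s y = parallel_fun L e s x" if "e \<in> parallel_edges G x0" for e s
    using that by (simp add: parallel_fun_def cong: if_cong)
  with edge hyp(1) show ?thesis
    unfolding measurement_def by (intro arg_cong[where f = vec_lambda] ext) (auto simp: constraints_def)
qed

text \<open>\<open>v\<close> is the velocity of a translation. Since it leaves the normals fixed,
  the offsets change linearly in time, so the straight line in direction \<open>v\<close> is itself
  a path of translated configurations.\<close>

lemma rigidity_matrix_translation: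
  assumes L: "is_labelling G x0 L"
    and pt: "\<And>i. i \<in> pt_verts G \<Longrightarrow> vecpart v i = b"
    and hyp: "\<And>j. j \<in> hyp_verts G \<Longrightarrow> vecpart v j = 0"
      "\<And>j. j \<in> hyp_verts G \<Longrightarrow> scalpart v j = b \<bullet> vecpart x j"
  shows "rigidity_matrix G L x0 x *v v = 0"
  unfolding rigidity_matrix_def
proof (rule jacobian_eq_0_if_constant_on_line)
  show "measurement G L x0 differentiable at x"
    by (rule jacobian_real_polynomial_function(1)) (rule real_polynomial_function_measurement)
next
  fix t
  have "vecpart (x + t *\<^sub>R v) i = vecpart x i + t *\<^sub>R vecpart v i"
    "scalpart (x + t *\<^sub>R v) i = scalpart x i + t * scalpart v i" for i
    by (simp_all add: vecpart_def scalpart_def vec_eq_iff)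
  then show "measurement G L x0 (x + t *\<^sub>R v) = measurement G L x0 x"
    by (intro measurement_translate[OF L, of _ _ "t *\<^sub>R b"]) (simp_all add: pt hyp)
qed

text \<open>The coordinates outside \<open>coords G\<close> are the dummy entries at point vertices;
  moving one of them counts as a translation by 0.\<close>

lemma rigidity_matrix_column_eq_0:
  assumes L: "is_labelling G x0 L" and k: "k \<notin> coords G"
  shows "rigidity_matrix G L x0 x $ c $ k = 0"
proof -
  obtain i where i: "k = (i, None)" "i \<notin> hyp_verts G"
    using k by (cases k) (auto simp: coords_def)
  have "rigidity_matrix G L x0 x *v axis k 1 = 0"
    using i by (intro rigidity_matrix_translation[OF L, of _ 0])
      (auto simp: vecpart_def scalpart_def axis_def vec_eq_iff)
  then show ?thesis
    by (simp add: matrix_vector_mult_basis column_def vec_eq_iff)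
qed

section \<open>Directions respecting the pinning, and dimension counts for the pinned kernel\<close>

definition pinned_space :: "'v ph_graph \<Rightarrow> ('v, 'd) coord set \<Rightarrow> ('v::finite, 'd::finite) config set" where
  "pinned_space G P = {v \<in> conf_space G. \<forall>k\<in>P. v $ k = 0}"

lemma subspace_pinned_space: "subspace (pinned_space G P)"
  by (auto simp: pinned_space_def conf_space_def subspace_def)

lemma pinned_kernel_eq:
  "pinned_kernel G L P x0 q = {v \<in> pinned_space G P. pinned_matrix G L P x0 q *v v = 0}"
  by (auto simp: pinned_kernel_def pinned_space_def)

lemma subspace_pinned_kernel: "subspace (pinned_kernel G L P x0 q)"
  unfolding pinned_kernel_eq using subspace_pinned_space[of G P]
  by (auto simp: subspace_def matrix_vector_right_distrib matrix_vector_mult_scaleR)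

lemma pinned_matrix_mult_pinned:
  assumes "\<And>k. k \<in> P \<Longrightarrow> v $ k = 0"
  shows "pinned_matrix G L P x0 q *v v = rigidity_matrix G L x0 q *v v"
  using assms unfolding matrix_vector_mult_def pinned_matrix_def
  by (auto simp: vec_eq_iff intro!: sum.cong)

text \<open>The columns in \<open>P\<close> and those outside \<open>coords G\<close> vanish, so the
  full column space is already reached from \<open>pinned_space\<close> and rank-nullity applies
  there. As the sum does not depend on \<open>q\<close>, comparing ranks amounts to comparing kernel
  dimensions.\<close>

lemma rank_add_dim_pinned_kernel:
  assumes L: "is_labelling G x0 L"
  shows "rank (pinned_matrix G L P x0 q) + dim (pinned_kernel G L P x0 q)
      = dim (pinned_space G P :: ('v::finite, 'd::finite) config set)"
proof -
  let ?M = "pinned_matrix G L P x0 q"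
  have "range ((*v) ?M) = (*v) ?M ` pinned_space G P"
  proof (intro equalityI image_subsetI)
    fix v :: "('v, 'd) config"
    define u where "u = (\<chi> k. if k \<in> coords G - P then v $ k else 0)"
    have eq: "?M $ c $ k * v $ k = ?M $ c $ k * u $ k" for c k
      by (simp add: pinned_matrix_def u_def rigidity_matrix_column_eq_0[OF L])
    have "?M *v v = ?M *v u"
      by (simp only: matrix_vector_mult_def eq)
    moreover have "u \<in> pinned_space G P"
      by (simp add: u_def pinned_space_def conf_space_def)
    ultimately show "?M *v v \<in> (*v) ?M ` pinned_space G P"
      by blast
  qed auto
  then show ?thesis
    using dim_image_add_dim_kernel[OF matrix_vector_mul_linear subspace_pinned_space, of ?M G P]
    by (simp add: rank_dim_range pinned_kernel_eq)
qed

text \<open>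
  The restriction of the infinitesimal motions to the coordinates in \<open>P\<close> is onto: translations
  reach the coordinates of the point vertex that is pinned entirely, and by minimality each further
  coordinate in \<open>P\<close> is the only nonzero one in \<open>P\<close> of some trivial motion.
\<close>
lemma dim_inf_motions:
  fixes x0 :: "('v::finite, 'd::finite) config"
  assumes L: "is_labelling G x0 L" and P: "minimal_pinning G L x0 P"
  shows "dim (inf_motions G L x0 x0) = CARD('d) * (CARD('d) + 1) div 2 + dim (pinned_kernel G L P x0 x0)"
proof -
  let ?K = "inf_motions G L x0 x0"
  define \<rho> :: "('v, 'd) config \<Rightarrow> ('v, 'd) config" where "\<rho> v = (\<chi> k. if k \<in> P then v $ k else 0)" for v
  have \<rho>: "linear \<rho>"
    by (auto simp: linear_iff \<rho>_def vec_eq_iff)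
  have K: "subspace ?K"
    by (auto simp: subspace_def inf_motions_def conf_space_def matrix_vector_right_distrib
        matrix_vector_mult_scaleR)
  have \<rho>K: "subspace (\<rho> ` ?K)"
    using \<rho> K by (rule linear_subspace_image)
  have pins: "pins G L x0 P" and min: "\<And>P'. P' \<subset> P \<Longrightarrow> \<not> pins G L x0 P'"
    and card: "card P = CARD('d) * (CARD('d) + 1) div 2"
    using P by (auto simp: minimal_pinning_def)
  then obtain i where i: "i \<in> pt_verts G" "\<And>s. (i, Some s) \<in> P" and PG: "P \<subseteq> coords G"
    by (auto simp: pins_def)
  have other: "axis k 1 \<in> \<rho> ` ?K" if k: "k \<in> P" "k \<notin> range (\<lambda>s. (i, Some s))" for k
  proof -
    \<comment> \<open>Without \<open>k\<close> the fully pinned vertex is kept, so what fails is the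
      exclusion of nonzero trivial motions.\<close>
    have "\<not> pins G L x0 (P - {k})"
      using k by (intro min) auto
    moreover have "\<forall>s. (i, Some s) \<in> P - {k}"
      using k i by auto
    ultimately obtain v where v: "v \<in> pinned_kernel G L (P - {k}) x0 x0" "v \<in> trivial_motions G x0" "v \<noteq> 0"
      using PG i unfolding pins_def by blast
    then have v0: "v $ k' = 0" if "k' \<in> P - {k}" for k'
      using that by (simp add: pinned_kernel_def)
    have vK: "v \<in> ?K"
      using v(1) pinned_matrix_mult_pinned[of "P - {k}" v]
      by (auto simp: pinned_kernel_def inf_motions_def)
    \<comment> \<open>Otherwise \<open>v\<close> would be a nonzero trivial motion respecting all of
      \<open>P\<close>.\<close>
    have "v $ k \<noteq> 0"
    proof
      assume "v $ k = 0"
      then have "v $ k' = 0" if "k' \<in> P" for k'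
        using v0 that by (cases "k' = k") auto
      then have "v \<in> pinned_kernel G L P x0 x0"
        using vK pinned_matrix_mult_pinned[of P v] by (auto simp: pinned_kernel_def inf_motions_def)
      then show False
        using pins v by (auto simp: pins_def)
    qed
    then have "\<rho> ((1 / v $ k) *\<^sub>R v) = axis k 1"
      using v0 k by (auto simp: \<rho>_def vec_eq_iff axis_def)
    then show ?thesis
      using subspace_mul[OF K vK] by (metis imageI)
  qed
  have point: "axis (i, Some s) 1 \<in> \<rho> ` ?K" for s
  proof -
    \<comment> \<open>The velocity of the unit translation in direction \<open>s\<close>.\<close>
    define v :: "('v, 'd) config" where
      "v = (\<chi> k. case k of
         (j, Some t) \<Rightarrow> if j \<in> pt_verts G then axis s 1 $ t else 0
       | (j, None) \<Rightarrow> if j \<in> pt_verts G then 0 else axis s 1 \<bullet> vecpart x0 j)"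
    have "rigidity_matrix G L x0 x0 *v v = 0"
      by (rule rigidity_matrix_translation[OF L, of _ "axis s 1"])
        (simp_all add: v_def vecpart_def scalpart_def hyp_verts_def vec_eq_iff)
    then have "v \<in> ?K"
      by (auto simp: inf_motions_def conf_space_def coords_def hyp_verts_def v_def)
    \<comment> \<open>Besides the wanted unit vector, the restricted translation has entries only at
      pins away from \<open>i\<close>; \<open>other\<close> puts these into the image, so they can
      be subtracted.\<close>
    moreover have "\<rho> v = axis (i, Some s) 1 + (\<Sum>k\<in>P - range (\<lambda>s. (i, Some s)). \<rho> v $ k *\<^sub>R axis k 1)"
    proof (rule vec_eq_iff[THEN iffD2], rule allI)
      fix k
      have sum: "(\<Sum>k'\<in>P - range (\<lambda>s. (i, Some s)). \<rho> v $ k' *\<^sub>R axis k' 1) $ k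
        = (if k \<in> P - range (\<lambda>s. (i, Some s)) then \<rho> v $ k else 0)"
        by (simp add: axis_def if_distrib cong: if_cong)
      have eq: "\<rho> v $ (i, Some t) = axis (i, Some s) 1 $ (i, Some t)" for t
        using i by (simp add: \<rho>_def v_def axis_def)
      show "\<rho> v $ k = (axis (i, Some s) 1 + (\<Sum>k\<in>P - range (\<lambda>s. (i, Some s)). \<rho> v $ k *\<^sub>R axis k 1)) $ k"
      proof (cases "k \<in> range (\<lambda>s. (i, Some s))")
        case True
        then show ?thesis
          unfolding vector_add_component sum using eq by force
      next
        case False
        then have "axis (i, Some s) 1 $ k = (0::real)"
          by (auto simp: axis_def)
        with False show ?thesis
          unfolding vector_add_component sum by (simp add: \<rho>_def)
      qed
    qed
    moreover have "(\<Sum>k\<in>P - range (\<lambda>s. (i, Some s)). \<rho> v $ k *\<^sub>R axis k 1) \<in> \<rho> ` ?K"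
      by (intro subspace_sum[OF \<rho>K] subspace_mul[OF \<rho>K] other) auto
    ultimately have "axis (i, Some s) 1 + (\<Sum>k\<in>P - range (\<lambda>s. (i, Some s)). \<rho> v $ k *\<^sub>R axis k 1)
        - (\<Sum>k\<in>P - range (\<lambda>s. (i, Some s)). \<rho> v $ k *\<^sub>R axis k 1) \<in> \<rho> ` ?K"
      by (intro subspace_diff[OF \<rho>K]) auto
    then show ?thesis
      by simp
  qed
  have "\<rho> ` ?K = {v. \<forall>k. k \<notin> P \<longrightarrow> v $ k = 0}"
  proof (intro equalityI subsetI)
    fix v :: "('v, 'd) config" assume v: "v \<in> {v. \<forall>k. k \<notin> P \<longrightarrow> v $ k = 0}"
    have "v = (\<Sum>k\<in>P. v $ k *\<^sub>R axis k 1)"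
      using v by (auto simp: vec_eq_iff axis_def if_distrib cong: if_cong)
    also have "\<dots> \<in> \<rho> ` ?K"
      using other point by (intro subspace_sum[OF \<rho>K] subspace_mul[OF \<rho>K]) blast
    finally show "v \<in> \<rho> ` ?K" .
  qed (auto simp: \<rho>_def)
  then have "dim (\<rho> ` ?K) = card P"
    using dim_substandard_cart[of P, where 'a = real] by (simp add: dim_vec_eq)
  \<comment> \<open>On vectors vanishing on \<open>P\<close>, deleting the pinned columns changes
    nothing, so the kernel of the restriction is the pinned kernel.\<close>
  moreover have "{v \<in> ?K. \<rho> v = 0} = pinned_kernel G L P x0 x0"
    using pinned_matrix_mult_pinned[of P]
    by (auto simp: \<rho>_def vec_eq_iff[of _ 0] pinned_kernel_def inf_motions_def)
  ultimately show ?thesis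
    using dim_image_add_dim_kernel[OF \<rho> K] card by simp
qed

section \<open>The push algorithm\<close>

text \<open>On the line through \<open>a\<close> (parameter 0) and \<open>q1\<close> (parameter 1),
  \<open>p\<close> has only finitely many zeros, while infinitely many parameters near 0 give points
  of \<open>U\<close>.\<close>

lemma real_polynomial_function_nonzero_dense:
  fixes B :: "'a::euclidean_space set"
  assumes p: "real_polynomial_function p" and B: "subspace B"
    and q: "q1 \<in> (+) x0 ` B" "p q1 \<noteq> 0" and U: "open U" "a \<in> U" "a \<in> (+) x0 ` B"
  obtains q where "q \<in> U" "q \<in> (+) x0 ` B" "p q \<noteq> 0"
proof -
  let ?l = "\<lambda>t::real. a + t *\<^sub>R (q1 - a)"
  have "open (?l -` U)"
    using U(1) by (intro open_vimage continuous_intros)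
  then have "\<not> finite (?l -` U)"
    using U(2) by (metis (mono_tags, lifting) add.right_neutral empty_iff finite_imp_not_open scaleR_zero_left vimageI)
  moreover have "finite {t. p (?l t) = 0}"
    using finite_zeros_real_polynomial_function_line[OF p, of a 1] q(2) by simp
  ultimately obtain t where t: "t \<in> ?l -` U" "p (?l t) \<noteq> 0"
    by (metis (mono_tags, lifting) finite_subset mem_Collect_eq subsetI)
  obtain b b1 where b: "a = x0 + b" "b \<in> B" "q1 = x0 + b1" "b1 \<in> B"
    using q(1) U(3) by auto
  have "?l t = x0 + (b + t *\<^sub>R (b1 - b))"
    by (simp add: b)
  moreover have "b + t *\<^sub>R (b1 - b) \<in> B"
    using B b by (intro subspace_add subspace_mul subspace_diff)
  ultimately have "?l t \<in> (+) x0 ` B"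
    by blast
  then show ?thesis
    using that t by blast
qed

lemma direction_translate:
  assumes "subspace B"
  shows "direction ((+) x0 ` B) = B"
proof (intro equalityI subsetI)
  fix v assume "v \<in> direction ((+) x0 ` B)"
  then show "v \<in> B"
    using assms by (auto simp: direction_def subspace_diff)
next
  fix v assume "v \<in> B"
  then have "v = (x0 + v) - (x0 + 0)" "x0 + v \<in> (+) x0 ` B" "x0 + 0 \<in> (+) x0 ` B"
    using assms by (auto simp only: subspace_0 add_diff_cancel_left diff_zero)
  then show "v \<in> direction ((+) x0 ` B)"
    unfolding direction_def by blast
qed

lemma rank_along_add_dim_kernel:
  assumes "subspace B"
  shows "rank_along G L P x0 ((+) x0 ` B) q + dim {v \<in> B. pinned_matrix G L P x0 q *v v = 0} = dim B"
  using dim_image_add_dim_kernel[OF matrix_vector_mul_linear assms, of "pinned_matrix G L P x0 q"]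
  by (simp add: rank_along_def direction_translate[OF assms])

text \<open>The points whose rank along \<open>B\<close> is at least that of \<open>q'\<close> are
  dense in the affine space, so one lies in the neighbourhood on which \<open>q\<close> is
  maximal.\<close>

lemma regular_point_max:
  assumes B: "subspace B" and reg: "regular_point G L P x0 ((+) x0 ` B) q" and q': "q' \<in> (+) x0 ` B"
  shows "rank_along G L P x0 ((+) x0 ` B) q' \<le> rank_along G L P x0 ((+) x0 ` B) q"
proof -
  let ?r = "\<lambda>q. dim ((*v) (pinned_matrix G L P x0 q) ` B)"
  have r: "rank_along G L P x0 ((+) x0 ` B) q = ?r q" for q
    by (simp add: rank_along_def direction_translate[OF B])
  obtain p where p: "real_polynomial_function p" "p q' \<noteq> 0" "\<And>q. p q \<noteq> 0 \<Longrightarrow> ?r q' \<le> ?r q"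
    using polynomial_witness_of_rank[OF real_polynomial_function_pinned_matrix B] by metis
  obtain U where U: "open U" "q \<in> U" "\<And>q'. q' \<in> U \<Longrightarrow> q' \<in> (+) x0 ` B \<Longrightarrow> ?r q' \<le> ?r q"
    and q: "q \<in> (+) x0 ` B"
    using reg unfolding regular_point_def r by auto
  obtain q'' where "q'' \<in> U" "q'' \<in> (+) x0 ` B" "p q'' \<noteq> 0"
    using real_polynomial_function_nonzero_dense[OF p(1) B q' p(2) U(1,2) q] .
  then show ?thesis
    using p(3) U(3) unfolding r by (meson order_trans)
qed

text \<open>Both ranks attain their maxima wherever certain polynomials do not vanish, and these two
  open dense subsets of the affine space meet.\<close>

lemma random_point_exists:
  fixes x0 :: "('v::finite, 'd::finite) config"
  assumes B: "subspace B"
  obtains q where "random_point G L P x0 ((+) x0 ` B) q"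
proof -
  let ?A = "(+) x0 ` B" and ?M = "pinned_matrix G L P x0"
  let ?r = "\<lambda>C q. dim ((*v) (?M q) ` C)"
  \<comment> \<open>Used with \<open>C = UNIV\<close> for the rank of the whole matrix and with
    \<open>C = B\<close> for the rank along the affine space.\<close>
  have ex: "\<exists>p q. real_polynomial_function p \<and> q \<in> ?A \<and> p q \<noteq> 0 \<and>
      (\<forall>q''. p q'' \<noteq> 0 \<longrightarrow> (\<forall>q'\<in>?A. ?r C q' \<le> ?r C q''))" if C: "subspace C" for C
  proof -
    have base: "x0 + 0 \<in> ?A"
      using B by (intro imageI subspace_0)
    \<comment> \<open>The rank is at most the number of rows; \<open>Suc\<close> makes the bound
      strict.\<close>
    have bound: "\<forall>q. q \<in> ?A \<longrightarrow> ?r C q < Suc CARD(('v, 'd) constr)"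
      using dim_subset_UNIV_cart le_imp_less_Suc by blast
    obtain q1 where q1: "q1 \<in> ?A" "\<And>q'. q' \<in> ?A \<Longrightarrow> ?r C q' \<le> ?r C q1"
      using ex_has_greatest_nat[of "\<lambda>q. q \<in> ?A", OF base bound] by blast
    obtain p where "real_polynomial_function p" "p q1 \<noteq> 0" "\<And>q. p q \<noteq> 0 \<Longrightarrow> ?r C q1 \<le> ?r C q"
      using polynomial_witness_of_rank[OF real_polynomial_function_pinned_matrix C] by metis
    then show ?thesis
      using q1 by (meson order_trans)
  qed
  obtain p1 q1 where 1: "real_polynomial_function p1" "q1 \<in> ?A" "p1 q1 \<noteq> 0"
    "\<And>q q'. p1 q \<noteq> 0 \<Longrightarrow> q' \<in> ?A \<Longrightarrow> ?r UNIV q' \<le> ?r UNIV q"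
    using ex[OF subspace_UNIV] by blast
  obtain p2 q2 where 2: "real_polynomial_function p2" "q2 \<in> ?A" "p2 q2 \<noteq> 0"
    "\<And>q q'. p2 q \<noteq> 0 \<Longrightarrow> q' \<in> ?A \<Longrightarrow> ?r B q' \<le> ?r B q"
    using ex[OF B] by blast
  have "open {q. p2 q \<noteq> 0}"
    by (intro open_Collect_neq continuous_on_const continuous_on_polymonial_function
        2(1)[unfolded real_polynomial_function_eq])
  then obtain q where q: "q \<in> ?A" "p1 q \<noteq> 0" "p2 q \<noteq> 0"
    using real_polynomial_function_nonzero_dense[OF 1(1) B 1(2,3), of "{q. p2 q \<noteq> 0}" q2] 2(2,3)
    by auto
  have "random_point G L P x0 ?A q"
    unfolding random_point_def regular_point_def rank_along_def direction_translate[OF B] rank_dim_range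
    using q 1(4) 2(4) by blast
  then show ?thesis by (rule that)
qed

lemma affine_eq_translate_subspace:
  assumes "affine A" "x0 \<in> A"
  obtains B where "subspace B" "A = (+) x0 ` B"
proof
  show "subspace ((+) (- x0) ` A)"
    using affine_diffs_subspace[OF assms] by simp
  show "A = (+) x0 ` (+) (- x0) ` A"
    by (simp add: image_image)
qed

section \<open>Detectability and a single step of the algorithm\<close>

locale flexible_framework =
  fixes G :: "'v::finite ph_graph"
    and x0 :: "('v, 'd::finite) config"
    and L :: "('v, 'd) labelling"
    and P :: "('v, 'd) coord set"
    and w :: "('v, 'd) config"
  assumes framework: "ph_framework G x0"
    and labelling: "is_labelling G x0 L"
    and pinning: "minimal_pinning G L x0 P"
    and dim_kernel: "dim (pinned_kernel G L P x0 x0) = 1"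
    and kernel: "pinned_kernel G L P x0 x0 = span {w}"
begin

abbreviation "M \<equiv> pinned_matrix G L P x0"
abbreviation "X \<equiv> pinned_kernel G L P x0"

text \<open>Serves both as the class of candidate direction spaces for detectability and as the
  invariant of the running states.\<close>

definition admissible :: "('v, 'd) config set \<Rightarrow> bool" where
  "admissible B \<longleftrightarrow> subspace B \<and> w \<in> B \<and> B \<subseteq> pinned_space G P"

lemma admissible_span_w: "admissible (span {w})"
proof -
  have "span {w} \<subseteq> pinned_space G P"
    unfolding kernel[symmetric] by (auto simp: pinned_kernel_eq)
  then show ?thesis
    by (simp add: admissible_def span_base)
qed

lemma admissible_insert:
  assumes "admissible B" "v \<in> X q"
  shows "admissible (span (insert v B))"
proof -
  have "span (insert v B) \<subseteq> pinned_space G P"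
    using assms by (intro span_minimal subspace_pinned_space) (auto simp: admissible_def pinned_kernel_eq)
  then show ?thesis
    using assms by (simp add: admissible_def span_base)
qed

lemma pinned_affine_iff:
  assumes B: "subspace B"
  shows "pinned_affine G P x0 ((+) x0 ` B) \<longleftrightarrow> B \<subseteq> pinned_space G P"
proof -
  have x0: "x0 $ k = 0" if "k \<notin> coords G" for k
    using framework that unfolding ph_framework_def conf_space_def by blast
  have "affine ((+) x0 ` B)"
    using subspace_imp_affine[OF B] affine_translation by blast
  moreover have "x0 \<in> (+) x0 ` B"
    using subspace_0[OF B] by (auto simp: image_iff)
  ultimately show ?thesis
    by (auto simp: pinned_affine_def pinned_space_def conf_space_def x0 subset_iff)
qed

lemma rank_le_iff: "rank (M q) \<le> rank (M x0) \<longleftrightarrow> 1 \<le> dim (X q)"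
  using rank_add_dim_pinned_kernel[OF labelling, of P q]
    rank_add_dim_pinned_kernel[OF labelling, of P x0] dim_kernel by linarith

text \<open>Since \<open>x0\<close> lies in the affine space, the rank at a random point is at least
  that at \<open>x0\<close>; with the assumed inequality the ranks, and hence the kernel dimensions,
  agree.\<close>

lemma dim_X_random_point:
  assumes B: "subspace B" and q: "random_point G L P x0 ((+) x0 ` B) q"
    and le: "rank (M q) \<le> rank (M x0)"
  shows "dim (X q) = 1"
proof -
  have "x0 + 0 \<in> (+) x0 ` B"
    using B by (intro imageI subspace_0)
  then have "rank (M x0) \<le> rank (M q)"
    using q by (auto simp: random_point_def)
  then show ?thesis
    using le rank_add_dim_pinned_kernel[OF labelling, of P q]
      rank_add_dim_pinned_kernel[OF labelling, of P x0] dim_kernel by linarith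
qed

lemma kernel_on_admissible:
  assumes "admissible B"
  shows "{v \<in> B. M x0 *v v = 0} = span {w}"
proof
  show "{v \<in> B. M x0 *v v = 0} \<subseteq> span {w}"
    using assms kernel by (auto simp: admissible_def pinned_kernel_eq)
  show "span {w} \<subseteq> {v \<in> B. M x0 *v v = 0}"
    using assms kernel span_minimal[of "{w}" B] by (auto simp: admissible_def pinned_kernel_eq)
qed

text \<open>The dimension of the unpinned motion space follows from \<open>dim_inf_motions\<close>,
  and \<open>kernel_on_admissible\<close> supplies the kernel condition, so regularity is all that
  remains to be found.\<close>

lemma linearly_detectable_iff:
  "linearly_detectable G L P x0 w \<longleftrightarrow>
    (\<exists>B. admissible B \<and> regular_point G L P x0 ((+) x0 ` B) x0)"
proof
  assume "linearly_detectable G L P x0 w"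
  then obtain A where A: "pinned_affine G P x0 A" "regular_point G L P x0 A x0"
    "{v \<in> direction A. M x0 *v v = 0} = span {w}"
    by (auto simp: linearly_detectable_def)
  then obtain B where B: "subspace B" "A = (+) x0 ` B"
    using affine_eq_translate_subspace[of A x0] by (auto simp: pinned_affine_def)
  have "w \<in> span {w}"
    by (simp add: span_base)
  then have "w \<in> B"
    using A(3) B direction_translate by blast
  then show "\<exists>B. admissible B \<and> regular_point G L P x0 ((+) x0 ` B) x0"
    using A B pinned_affine_iff by (auto simp: admissible_def)
next
  assume "\<exists>B. admissible B \<and> regular_point G L P x0 ((+) x0 ` B) x0"
  then obtain B where B: "admissible B" "regular_point G L P x0 ((+) x0 ` B) x0"
    by blast
  then have "subspace B" "B \<subseteq> pinned_space G P"
    by (auto simp: admissible_def)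
  then have "pinned_affine G P x0 ((+) x0 ` B)" "direction ((+) x0 ` B) = B"
    by (simp_all add: pinned_affine_iff direction_translate)
  then show "linearly_detectable G L P x0 w"
    unfolding linearly_detectable_def
    using B(2) kernel_on_admissible[OF B(1)] dim_inf_motions[OF labelling pinning] dim_kernel by auto
qed

lemma linearly_detectable_if_Extends:
  assumes B: "admissible B" and q: "random_point G L P x0 ((+) x0 ` B) q"
    and le: "rank (M q) \<le> rank (M x0)" and sub: "X q \<subseteq> B"
  shows "linearly_detectable G L P x0 w"
proof -
  let ?A = "(+) x0 ` B"
  have sB: "subspace B" and BW: "B \<subseteq> pinned_space G P"
    using B by (auto simp: admissible_def)
  have "{v \<in> B. M q *v v = 0} = X q"
    using sub BW by (auto simp: pinned_kernel_eq)
  then have "rank_along G L P x0 ?A q + 1 = dim B"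
    using rank_along_add_dim_kernel[OF sB, of G L P x0 q] dim_X_random_point[OF sB q le] by simp
  moreover have "rank_along G L P x0 ?A x0 + 1 = dim B"
    using rank_along_add_dim_kernel[OF sB, of G L P x0 x0] kernel_on_admissible[OF B]
      kernel dim_kernel by simp
  moreover have "rank_along G L P x0 ?A q' \<le> rank_along G L P x0 ?A q" if "q' \<in> ?A" for q'
    using regular_point_max[OF sB _ that] q by (auto simp: random_point_def)
  moreover have "x0 \<in> ?A"
    using subspace_0[OF sB] by (auto simp: image_iff)
  ultimately have "regular_point G L P x0 ?A x0"
    \<comment> \<open>The maximum at \<open>q\<close> is global on \<open>?A\<close>, so
      \<open>UNIV\<close> serves as the neighbourhood of \<open>x0\<close>.\<close>
    unfolding regular_point_def by (metis Int_iff UNIV_I add_right_imp_eq open_UNIV)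
  then show ?thesis
    using B linearly_detectable_iff by blast
qed

text \<open>Although \<open>q\<close> is random only in the smaller space, regularity of
  \<open>x0\<close> in the larger one bounds the rank along \<open>B'\<close> at \<open>q\<close>.
  Thus \<open>X q\<close> meets \<open>B'\<close> in dimension at least 1, and being a line it lies
  inside.\<close>

lemma pushed_kernel_in_witness:
  assumes B': "admissible B'" "regular_point G L P x0 ((+) x0 ` B') x0"
    and B: "subspace B" "B \<subseteq> B'" and q: "random_point G L P x0 ((+) x0 ` B) q"
  shows "rank (M q) \<le> rank (M x0)" "X q \<subseteq> B'"
proof -
  have sB': "subspace B'" and BW: "B' \<subseteq> pinned_space G P"
    using B'(1) by (auto simp: admissible_def)
  let ?K = "{v \<in> B'. M q *v v = 0}"
  have "q \<in> (+) x0 ` B'"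
    using q B(2) by (auto simp: random_point_def regular_point_def)
  then have "rank_along G L P x0 ((+) x0 ` B') q \<le> rank_along G L P x0 ((+) x0 ` B') x0"
    by (rule regular_point_max[OF sB' B'(2)])
  then have K: "1 \<le> dim ?K"
    using rank_along_add_dim_kernel[OF sB', of G L P x0 q] rank_along_add_dim_kernel[OF sB', of G L P x0 x0]
      kernel_on_admissible[OF B'(1)] kernel dim_kernel by simp
  have sub: "?K \<subseteq> X q"
    using BW by (auto simp: pinned_kernel_eq)
  then have "dim ?K \<le> dim (X q)"
    by (rule dim_subset)
  then show le: "rank (M q) \<le> rank (M x0)"
    using K rank_le_iff by simp
  have "subspace ?K"
    using sB' by (auto simp: subspace_def matrix_vector_right_distrib matrix_vector_mult_scaleR)
  then have "?K = X q"
    using sub K dim_X_random_point[OF B(1) q le] by (intro subspace_dim_equal subspace_pinned_kernel) auto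
  then show "X q \<subseteq> B'"
    by blast
qed

text \<open>A running state is never stuck: random points exist, and in the enlarging case the
  kernel is a line, so it has a unit generator.\<close>

lemma push_step_exists:
  assumes B: "subspace B"
  shows "\<exists>s. push_step G L P x0 (Running B) s"
proof -
  obtain q where q: "random_point G L P x0 ((+) x0 ` B) q"
    using random_point_exists[OF B] .
  show ?thesis
  proof (cases "rank (M q) \<le> rank (M x0) \<and> \<not> X q \<subseteq> B")
    case True
    \<comment> \<open>A vector of \<open>X q\<close> outside \<open>B\<close> is nonzero because
      \<open>B\<close> contains 0.\<close>
    then obtain u where u: "u \<in> X q" "u \<noteq> 0"
      using subspace_0[OF B] by fastforce
    let ?v = "(1 / norm u) *\<^sub>R u"
    have "?v \<in> X q"
      using subspace_pinned_kernel u(1) by (rule subspace_mul)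
    then have "span {?v} \<subseteq> X q"
      by (intro span_minimal subspace_pinned_kernel) simp
    moreover have "dim (X q) = 1"
      using dim_X_random_point[OF B q] True by blast
    moreover have "dim (span {?v}) = 1"
      using u(2) by (simp add: dim_insert)
    ultimately have "span {?v} = X q"
      by (intro subspace_dim_equal subspace_pinned_kernel subspace_span) auto
    moreover have "norm ?v = 1"
      using u(2) by simp
    ultimately show ?thesis
      using push_step.intros(3)[OF q, of ?v] True by (metis not_less)
  next
    case False
    then show ?thesis
      using push_step.intros(1,2)[OF q] by (metis not_less)
  qed
qed

section \<open>Executions of the algorithm\<close>

context
  fixes \<sigma> :: "nat \<Rightarrow> ('v, 'd) config push_state"
  assumes exec: "push_execution G L P x0 w \<sigma>"
begin

lemma \<sigma>_0: "\<sigma> 0 = Running (span {w})"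
  using exec by (simp add: push_execution_def)

lemma \<sigma>_Suc:
  "if \<exists>s. push_step G L P x0 (\<sigma> t) s
    then push_step G L P x0 (\<sigma> t) (\<sigma> (Suc t)) else \<sigma> (Suc t) = \<sigma> t"
  using exec unfolding push_execution_def by blast

lemma \<sigma>_Suc_cases: "push_step G L P x0 (\<sigma> t) (\<sigma> (Suc t)) \<or> \<sigma> (Suc t) = \<sigma> t"
  using \<sigma>_Suc[of t] by presburger

lemma \<sigma>_Suc_Running:
  assumes "\<sigma> t = Running B" "subspace B"
  shows "push_step G L P x0 (Running B) (\<sigma> (Suc t))"
  using \<sigma>_Suc[of t] push_step_exists[OF assms(2)] assms(1) by simp

lemma Extends_sound:
  "case \<sigma> t of Running B \<Rightarrow> admissible B | Extends A \<Rightarrow> linearly_detectable G L P x0 w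
    | Does_Not_Extend \<Rightarrow> True"
proof (induction t)
  case 0
  show ?case by (simp add: \<sigma>_0 admissible_span_w)
next
  case (Suc t)
  from \<sigma>_Suc_cases[of t] show ?case
  proof
    assume "push_step G L P x0 (\<sigma> t) (\<sigma> (Suc t))"
    then show ?thesis
    proof cases
      case (2 B q)
      then show ?thesis
        using Suc.IH linearly_detectable_if_Extends[of B q] by simp
    next
      case (3 B q v)
      then show ?thesis
        using Suc.IH admissible_insert[of B v q] by (simp add: span_base)
    qed simp
  next
    assume "\<sigma> (Suc t) = \<sigma> t"
    then show ?thesis using Suc.IH by simp
  qed
qed

lemma Extends_complete:
  assumes "linearly_detectable G L P x0 w"
  shows "\<exists>t A. \<sigma> t = Extends A"
proof (rule ccontr)
  assume never: "\<not> (\<exists>t A. \<sigma> t = Extends A)"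
  obtain B' where B': "admissible B'" "regular_point G L P x0 ((+) x0 ` B') x0"
    using assms linearly_detectable_iff by blast
  \<comment> \<open>Without a positive output the run would continue forever inside
    \<open>B'\<close>, gaining one dimension per step.\<close>
  have "\<exists>B. \<sigma> t = Running B \<and> subspace B \<and> B \<subseteq> B' \<and> t \<le> dim B" for t
  proof (induction t)
    case 0
    have "span {w} \<subseteq> B'"
      using B'(1) by (intro span_minimal) (auto simp: admissible_def)
    then show ?case by (simp add: \<sigma>_0)
  next
    case (Suc t)
    then obtain B where B: "\<sigma> t = Running B" "subspace B" "B \<subseteq> B'" "t \<le> dim B"
      by blast
    from \<sigma>_Suc_Running[OF B(1,2)] show ?case
    proof cases
      case (1 q)
      then show ?thesis
        using pushed_kernel_in_witness(1)[OF B' B(2,3) 1(2)] 1(3) by simp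
    next
      case (2 q)
      then show ?thesis using never by blast
    next
      case (3 q v)
      have "v \<in> X q"
        using 3 by (simp add: span_base)
      then have "span (insert v B) \<subseteq> B'"
        using pushed_kernel_in_witness(2)[OF B' B(2,3) 3(2)] B(3) B'(1)
        by (intro span_minimal) (auto simp: admissible_def)
      \<comment> \<open>If \<open>v\<close> were in \<open>B\<close>, its span \<open>X q\<close>
        would be too, and the algorithm would have stopped.\<close>
      moreover have "v \<notin> B"
        using 3 span_minimal[of "{v}" B] B(2) by auto
      then have "dim (insert v B) = dim B + 1"
        using B(2) by (simp add: dim_insert span_eq_iff[THEN iffD2])
      ultimately show ?thesis
        using 3(1) B(4) by simp
    qed
  qed
  \<comment> \<open>Take \<open>t = Suc (dim B')\<close>.\<close>
  then obtain B where "B \<subseteq> B'" "Suc (dim B') \<le> dim B"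
    by blast
  then show False
    using dim_subset[of B B'] by simp
qed

end

end

theorem lemma6p1:
  fixes G :: "'v::finite ph_graph"
    and x0 :: "('v, 'd::finite) config"
    and L :: "('v, 'd) labelling"
    and P :: "('v, 'd) coord set"
    and w :: "('v, 'd) config"
    and \<sigma> :: "nat \<Rightarrow> ('v, 'd) config push_state"
  assumes "isostatic_graph TYPE('d) G"
    and "ph_framework G x0"
    and "is_labelling G x0 L"
    and "minimal_pinning G L x0 P"
    and "dim (pinned_kernel G L P x0 x0) = 1"
    and "pinned_kernel G L P x0 x0 = span {w}"
    and "push_execution G L P x0 w \<sigma>"
  shows "linearly_detectable G L P x0 w \<longleftrightarrow> (\<exists>t A. \<sigma> t = Extends A)"
proof -
  interpret flexible_framework G x0 L P w
    using assms(2-6) by unfold_locales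
  show ?thesis
  proof
    assume "linearly_detectable G L P x0 w"
    then show "\<exists>t A. \<sigma> t = Extends A"
      by (rule Extends_complete[OF assms(7)])
  next
    assume "\<exists>t A. \<sigma> t = Extends A"
    then obtain t A where "\<sigma> t = Extends A"
      by blast
    then show "linearly_detectable G L P x0 w"
      using Extends_sound[OF assms(7), of t] by simp
  qed
qed

end
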